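(* Let $\lambda_0,\lambda_1,\lambda_2\in\mathbb{R}$ be distinct and let $\varrho_0,\varrho_1,\varrho_2>0$. For phases $\vartheta_0,\vartheta_1,\vartheta_2\in\mathbb{R}$ put $$M(\vartheta_0,\vartheta_1,\vartheta_2)=\sup_{t\in\mathbb{R}}\bigl|\varrho_0e^{i\vartheta_0}e^{i\lambda_0t}+\varrho_1e^{i\vartheta_1}e^{i\lambda_1t}+\varrho_2e^{i\vartheta_2}e^{i\lambda_2t}\bigr|.$$ Let $G$ be the smallest additive subgroup of $\mathbb{R}$ containing $\lambda_1-\lambda_0$ and $\lambda_2-\lambda_0$. (a) If $G$ is dense in $\mathbb{R}$, then $M(\vartheta_0,\vartheta_1,\vartheta_2)$ is independent of the phases $\vartheta_0,\vartheta_1,\vartheta_2$ and equals $\varrho_0+\varrho_1+\varrho_2$. (b) Otherwise, let $d=\gcd(\lambda_1-\lambda_0,\lambda_2-\lambda_0)$ be a generator of $G$. Then the phases $\vartheta_0,\vartheta_1,\vartheta_2$ for which $M(\vartheta_0,\vartheta_1,\vartheta_2)$ is minimal are given by $$\vartheta_0(\lambda_2-\lambda_1)+\vartheta_1(\lambda_0-\lambda_2)+\vartheta_2(\lambda_1-\lambda_0)\equiv d\pi \pmod{2d\pi},$$ that is, $M$ attains its minimum over $\mathbb{R}^3$ at $(\vartheta_0,\vartheta_1,\vartheta_2)$ if and only if this congruence holds. In particular, minimizing phases may be chosen among $0$ and $\pi$.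
   Context: For real numbers, $x\equiv y \pmod{m}$ means $x-y\in m\mathbb{Z}$. When $G$ is not dense in $\mathbb{R}$ it is of the form $d\mathbb{Z}$, and $d$ is called the gcd of $\lambda_1-\lambda_0$ and $\lambda_2-\lambda_0$. *)

theory Defs
  imports
    "HOL-Analysis.Analysis"
    "HOL-Computational_Algebra.Group_Closure"
    "HOL-Library.Real_Mod"
begin

(* The set of moduli is nonempty and bounded by the sum of the absolute values of the r's, so
   the real-valued SUP is the actual supremum. *)
definition trinomial_sup ::
  "real \<Rightarrow> real \<Rightarrow> real \<Rightarrow> real \<Rightarrow> real \<Rightarrow> real \<Rightarrow> real \<Rightarrow> real \<Rightarrow> real \<Rightarrow> real" where
  "trinomial_sup l0 l1 l2 r0 r1 r2 \<theta>0 \<theta>1 \<theta>2 =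
     (SUP t::real. cmod
        (of_real r0 * exp (\<i> * of_real \<theta>0) * exp (\<i> * of_real l0 * of_real t)
       + of_real r1 * exp (\<i> * of_real \<theta>1) * exp (\<i> * of_real l1 * of_real t)
       + of_real r2 * exp (\<i> * of_real \<theta>2) * exp (\<i> * of_real l2 * of_real t)))"

definition minimizing_phases ::
  "real \<Rightarrow> real \<Rightarrow> real \<Rightarrow> real \<Rightarrow> real \<Rightarrow> real \<Rightarrow> real \<Rightarrow> real \<Rightarrow> real \<Rightarrow> bool" where
  "minimizing_phases l0 l1 l2 r0 r1 r2 \<theta>0 \<theta>1 \<theta>2 \<longleftrightarrow>
     (\<forall>\<phi>0 \<phi>1 \<phi>2. trinomial_sup l0 l1 l2 r0 r1 r2 \<theta>0 \<theta>1 \<theta>2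
                \<le> trinomial_sup l0 l1 l2 r0 r1 r2 \<phi>0 \<phi>1 \<phi>2)"

(* In a real vector space group_closure S is the additive subgroup generated by S (no scalar
   multiplication); we record that it is the smallest one. *)
lemma group_closure_least:
  fixes S H :: "real set"
  assumes "S \<subseteq> H" "0 \<in> H" "\<And>x y. x \<in> H \<Longrightarrow> y \<in> H \<Longrightarrow> x - y \<in> H"
  shows "group_closure S \<subseteq> H"
proof
  fix x assume "x \<in> group_closure S"
  then show "x \<in> H" by induction (use assms in auto)
qed

(* The congruence from Real_Mod is the usual one, for moduli of either sign. *)
lemma rcong_iff_diff_multiple:
  "[x = y] (rmod m) \<longleftrightarrow> (\<exists>k::int. x - y = of_int k * m)"
proof -
  have "[x = y] (rmod m) \<longleftrightarrow> [y = x] (rmod m)" by (rule rcong_sym_iff)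
  also have "\<dots> \<longleftrightarrow> (\<exists>k::int. x - y = of_int k * m)"
    by (auto simp: rcong_altdef algebra_simps)
  finally show ?thesis .
qed

end

theory Submission
  imports Defs
begin

text \<open>
  If \<open>G\<close> is dense, the three terms can be brought arbitrarily close to a common direction.
  Otherwise write \<open>l1 - l0 = m1 d\<close> and \<open>l2 - l0 = m2 d\<close> with \<open>m1\<close>, \<open>m2\<close> coprime. Up to a common
  rotation, the angle triples \<open>y\<close> reached by the flow of \<open>t\<close> are exactly those with a prescribed value of
  \<open>J y = (m2 - m1) y0 - m2 y1 + m1 y2\<close> modulo \<open>2 \<pi>\<close>, and by complex conjugation the supremum only
  depends on \<open>\<plusminus>J\<close>. So it suffices to improve any \<open>y\<close> with \<open>J y \<equiv> \<pi>\<close> to some \<open>z\<close> of larger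
  modulus with \<open>J z \<equiv> \<plusminus>c\<close>, given \<open>\<bar>c\<bar> < \<pi>\<close>. If the three angles have representatives pairwise at
  distance at most \<open>\<pi>\<close>, then \<open>J y\<close> is an odd multiple of \<open>\<pi>\<close> and scaling \<open>y\<close> by \<open>c / J y\<close> brings
  all angles closer together. If not, some term has negative inner product with the sum of the
  other two, and turning that term alone, in the right direction, by \<open>\<pi> - \<bar>c\<bar>\<close> over the modulus
  of its coefficient in \<open>J\<close>, increases the modulus.
\<close>

section \<open>The modulus of a three-term sum as a function of its angles\<close>

definition trimod :: "real \<Rightarrow> real \<Rightarrow> real \<Rightarrow> real \<Rightarrow> real \<Rightarrow> real \<Rightarrow> real" where
  "trimod r0 r1 r2 y0 y1 y2 =
     cmod (of_real r0 * cis y0 + of_real r1 * cis y1 + of_real r2 * cis y2)"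

lemma trinomial_sup_eq:
  "trinomial_sup l0 l1 l2 r0 r1 r2 \<theta>0 \<theta>1 \<theta>2 =
     (SUP t. trimod r0 r1 r2 (\<theta>0 + l0 * t) (\<theta>1 + l1 * t) (\<theta>2 + l2 * t))"
  unfolding trinomial_sup_def trimod_def cis_conv_exp
  by (simp add: exp_add distrib_left mult.assoc)

lemma trimod_le:
  assumes "r0 > 0" "r1 > 0" "r2 > 0"
  shows "trimod r0 r1 r2 y0 y1 y2 \<le> r0 + r1 + r2"
proof -
  have "trimod r0 r1 r2 y0 y1 y2 \<le> cmod (of_real r0 * cis y0) + cmod (of_real r1 * cis y1)
      + cmod (of_real r2 * cis y2)"
    unfolding trimod_def by (meson norm_triangle_ineq norm_triangle_le order.refl add_mono order_trans)
  then show ?thesis using assms by (simp add: norm_mult)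
qed

lemma trimod_le_sup:
  assumes "r0 > 0" "r1 > 0" "r2 > 0"
  shows "trimod r0 r1 r2 (\<theta>0 + l0 * t) (\<theta>1 + l1 * t) (\<theta>2 + l2 * t)
    \<le> trinomial_sup l0 l1 l2 r0 r1 r2 \<theta>0 \<theta>1 \<theta>2"
  unfolding trinomial_sup_eq
  by (rule cSUP_upper) (use trimod_le[OF assms] in \<open>auto intro!: bdd_aboveI\<close>)

lemma trimod_shift:
  "trimod r0 r1 r2 (a + y0) (a + y1) (a + y2) = trimod r0 r1 r2 y0 y1 y2"
proof -
  have "of_real r0 * cis (a + y0) + of_real r1 * cis (a + y1) + of_real r2 * cis (a + y2)
    = cis a * (of_real r0 * cis y0 + of_real r1 * cis y1 + of_real r2 * cis y2)"
    by (simp add: cis_mult[symmetric] algebra_simps)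
  then show ?thesis by (simp add: trimod_def norm_mult)
qed

lemma cis_add_2pi_int: "cis (y + 2 * pi * of_int j) = cis y"
  by (simp add: cis_mult[symmetric])

lemma trimod_periodic:
  "trimod r0 r1 r2 (y0 + 2 * pi * of_int a) (y1 + 2 * pi * of_int b) (y2 + 2 * pi * of_int c)
    = trimod r0 r1 r2 y0 y1 y2"
  by (simp only: trimod_def cis_add_2pi_int)

lemma trimod_minus:
  "trimod r0 r1 r2 (- y0) (- y1) (- y2) = trimod r0 r1 r2 y0 y1 y2"
proof -
  have "of_real r0 * cis (- y0) + of_real r1 * cis (- y1) + of_real r2 * cis (- y2)
    = cnj (of_real r0 * cis y0 + of_real r1 * cis y1 + of_real r2 * cis y2)"
    by (simp add: cis_cnj)
  then show ?thesis unfolding trimod_def by (simp only: complex_mod_cnj)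
qed

lemma trimod_rotate:
  "trimod r0 r1 r2 y0 y1 y2 = trimod r1 r2 r0 y1 y2 y0"
  by (simp add: trimod_def algebra_simps)

text \<open>Law of cosines: with positive radii, moduli can be compared through the cosines of the
  angle differences.\<close>

lemma trimod_power2:
  "(trimod r0 r1 r2 y0 y1 y2)\<^sup>2 = r0\<^sup>2 + r1\<^sup>2 + r2\<^sup>2
     + 2 * r0 * r1 * cos (y0 - y1) + 2 * r1 * r2 * cos (y1 - y2) + 2 * r0 * r2 * cos (y0 - y2)"
proof -
  have "(r * cos x)\<^sup>2 + (r * sin x)\<^sup>2 = r\<^sup>2" for r x :: real
    by (simp add: power_mult_distrib flip: distrib_left)
  from this[of r0 y0] this[of r1 y1] this[of r2 y2] show ?thesis
    unfolding trimod_def cmod_power2 by (simp add: cos_diff power2_eq_square algebra_simps)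
qed

section \<open>Two moves that increase the modulus\<close>

text \<open>Scaling shrinks every angle difference, and cosine strictly decreases on
  \<open>{0..pi}\<close>; some difference is nonzero, so the gain is strict. The factor may be zero
  or negative because the value aimed at later has either sign.\<close>

lemma trimod_scale_less:
  assumes r: "r0 > 0" "r1 > 0" "r2 > 0" and s: "\<bar>s\<bar> < 1"
    and y: "\<bar>y0 - y1\<bar> \<le> pi" "\<bar>y1 - y2\<bar> \<le> pi" "\<bar>y0 - y2\<bar> \<le> pi"
    and ne: "\<not> (y0 = y1 \<and> y1 = y2)"
  shows "trimod r0 r1 r2 y0 y1 y2 < trimod r0 r1 r2 (s * y0) (s * y1) (s * y2)"
proof -
  have lt: "cos u < cos (s * u)" if "\<bar>u\<bar> \<le> pi" "u \<noteq> 0" for u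
  proof -
    have "\<bar>s * u\<bar> < \<bar>u\<bar>" using s that by (simp add: abs_mult)
    then have "cos \<bar>u\<bar> < cos \<bar>s * u\<bar>" using that by (intro cos_monotone_0_pi) auto
    then show ?thesis by simp
  qed
  have le: "cos u \<le> cos (s * u)" if "\<bar>u\<bar> \<le> pi" for u
    using lt[OF that] by (cases "u = 0") auto
  have r': "2 * r0 * r1 > 0" "2 * r1 * r2 > 0" "2 * r0 * r2 > 0" using r by auto
  note le' = mult_left_mono[OF le[OF y(1)], of "2 * r0 * r1"]
    mult_left_mono[OF le[OF y(2)], of "2 * r1 * r2"]
    mult_left_mono[OF le[OF y(3)], of "2 * r0 * r2"]
  have "(trimod r0 r1 r2 y0 y1 y2)\<^sup>2 < (trimod r0 r1 r2 (s * y0) (s * y1) (s * y2))\<^sup>2"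
  proof (cases "y0 = y1")
    case False
    have "2 * r0 * r1 * cos (y0 - y1) < 2 * r0 * r1 * cos (s * (y0 - y1))"
      using lt[OF y(1)] False r'(1) by (intro mult_strict_left_mono) auto
    then show ?thesis using le' r' unfolding trimod_power2 right_diff_distrib by linarith
  next
    case True
    then have "2 * r1 * r2 * cos (y1 - y2) < 2 * r1 * r2 * cos (s * (y1 - y2))"
      using lt[OF y(2)] ne r'(2) by (intro mult_strict_left_mono) auto
    then show ?thesis using le' r' unfolding trimod_power2 right_diff_distrib by linarith
  qed
  then show ?thesis by (rule power2_less_imp_less) (simp add: trimod_def)
qed

lemma trimod_turn_less:
  assumes r: "r0 > 0" and neg: "r1 * cos (y0 - y1) + r2 * cos (y0 - y2) < 0"
    and h: "0 < h" "h \<le> pi"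
  shows "\<exists>x. (x = h \<or> x = - h) \<and> trimod r0 r1 r2 y0 y1 y2 < trimod r0 r1 r2 (y0 + x) y1 y2"
proof -
  \<comment> \<open>\<open>P + i Q\<close> is \<open>cis y0\<close> times the conjugate of the sum
    of the other two terms, so \<open>r0 * P\<close> is the inner product of the first term with
    that sum. Turning by \<open>x\<close> replaces \<open>P\<close> by
    \<open>P * cos x - Q * sin x\<close>.\<close>
  define P where "P = r1 * cos (y0 - y1) + r2 * cos (y0 - y2)"
  define Q where "Q = r1 * sin (y0 - y1) + r2 * sin (y0 - y2)"
  \<comment> \<open>This sign makes \<open>- Q * sin x\<close> nonnegative, while
    \<open>P * cos x > P\<close> because \<open>P < 0\<close>.\<close>
  define x where "x = (if Q \<ge> 0 then - h else h)"
  have "sin h \<ge> 0" "cos h < 1"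
    using h cos_monotone_0_pi[of 0 h] by (auto intro: sin_ge_zero)
  then have sc: "Q * sin x \<le> 0" "cos x < 1"
    by (auto simp: x_def mult_nonpos_nonneg)
  have "P * 1 < P * cos x"
    by (rule mult_strict_left_mono_neg) (use sc neg in \<open>auto simp: P_def\<close>)
  then have "P < P * cos x - Q * sin x" using sc by simp
  then have "2 * r0 * P < 2 * r0 * (P * cos x - Q * sin x)" using r by simp
  moreover have "cos (y0 + x - z) = cos (y0 - z) * cos x - sin (y0 - z) * sin x" for z
    using cos_add[of "y0 - z" x] by (simp add: algebra_simps)
  ultimately have "(trimod r0 r1 r2 y0 y1 y2)\<^sup>2 < (trimod r0 r1 r2 (y0 + x) y1 y2)\<^sup>2"
    unfolding trimod_power2 P_def Q_def by (simp only:) (simp add: algebra_simps)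
  then have "trimod r0 r1 r2 y0 y1 y2 < trimod r0 r1 r2 (y0 + x) y1 y2"
    by (rule power2_less_imp_less) (simp add: trimod_def)
  then show ?thesis by (auto simp: x_def split: if_splits)
qed

section \<open>Positions of three angles on the circle\<close>

lemma cos_neg_of_gt:
  assumes "pi / 2 < \<bar>u\<bar>" "\<bar>u\<bar> < 3 * pi / 2" shows "cos u < 0"
proof -
  have "cos (pi - \<bar>u\<bar>) > 0" using assms by (intro cos_gt_zero_pi) auto
  then show ?thesis by (simp add: cos_diff)
qed

lemma cos_nonpos_of_ge:
  assumes "pi / 2 \<le> \<bar>u\<bar>" "\<bar>u\<bar> \<le> 3 * pi / 2" shows "cos u \<le> 0"
proof -
  have "cos (pi - \<bar>u\<bar>) \<ge> 0" using assms by (intro cos_ge_zero) auto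
  then show ?thesis by (simp add: cos_diff)
qed

lemma reduce_mod_2pi:
  obtains j :: int where "- pi < y + 2 * pi * of_int j" "y + 2 * pi * of_int j \<le> pi"
proof -
  \<comment> \<open>The ceiling puts the closed end of the interval at \<open>pi\<close>, so that a
    representative other than \<open>pi\<close> has absolute value below \<open>pi\<close>.\<close>
  obtain j :: int where "of_int j - 1 < (y - pi) / (2 * pi)" "(y - pi) / (2 * pi) \<le> of_int j"
    using ceiling_correct by blast
  then show ?thesis
    by (intro that[of "- j"]) (auto simp: less_divide_eq divide_le_eq algebra_simps)
qed

text \<open>Measure the other two angles from \<open>y0\<close>, as \<open>u\<close> and
  \<open>v\<close> in the interval from \<open>- pi\<close> to \<open>pi\<close>. If
  \<open>\<bar>u - v\<bar> > pi\<close>, either both exceed \<open>pi / 2\<close> in absolute value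
  and term 0 is opposed, or one of them is at most \<open>pi / 2\<close> and the term at the other
  one is opposed.\<close>

lemma half_circle_or_opposed:
  assumes r: "r0 > 0" "r1 > 0" "r2 > 0"
  obtains (half) a b c :: int where
      "\<bar>(y0 + 2 * pi * of_int a) - (y1 + 2 * pi * of_int b)\<bar> \<le> pi"
      "\<bar>(y1 + 2 * pi * of_int b) - (y2 + 2 * pi * of_int c)\<bar> \<le> pi"
      "\<bar>(y0 + 2 * pi * of_int a) - (y2 + 2 * pi * of_int c)\<bar> \<le> pi"
    | (opp0) "r1 * cos (y0 - y1) + r2 * cos (y0 - y2) < 0"
    | (opp1) "r2 * cos (y1 - y2) + r0 * cos (y1 - y0) < 0"
    | (opp2) "r0 * cos (y2 - y0) + r1 * cos (y2 - y1) < 0"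
proof -
  obtain b where b: "- pi < (y1 - y0) + 2 * pi * of_int b" "(y1 - y0) + 2 * pi * of_int b \<le> pi"
    by (rule reduce_mod_2pi)
  obtain c where c: "- pi < (y2 - y0) + 2 * pi * of_int c" "(y2 - y0) + 2 * pi * of_int c \<le> pi"
    by (rule reduce_mod_2pi)
  define u v where "u = (y1 - y0) + 2 * pi * of_int b" and "v = (y2 - y0) + 2 * pi * of_int c"
  have "cos u = cos (y1 - y0)" "cos v = cos (y2 - y0)"
    unfolding u_def v_def by (simp_all add: cos_add)
  then have cu: "cos (y0 - y1) = cos u" "cos (y1 - y0) = cos u"
    and cv: "cos (y0 - y2) = cos v" "cos (y2 - y0) = cos v"
    by (metis cos_minus minus_diff_eq)+
  have "u - v = (y1 - y2) + 2 * pi * of_int (b - c)"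
    by (simp add: u_def v_def algebra_simps)
  then have "cos (u - v) = cos (y1 - y2)" by (simp only: cos_add sin_int_2pin cos_int_2pin mult_1_right mult_zero_right diff_zero)
  then have cw: "cos (y1 - y2) = cos (u - v)" "cos (y2 - y1) = cos (u - v)"
    by (metis cos_minus minus_diff_eq)+
  have sum_neg: "s * x + t * y < 0" "t * y + s * x < 0"
    if "s > 0" "t > 0" "x < 0" "y \<le> 0" for s t x y :: real
    using mult_pos_neg[of s x] mult_nonneg_nonpos[of t y] that by simp_all
  show ?thesis
  proof (cases "\<bar>u - v\<bar> \<le> pi")
    case True
    with b c show ?thesis by (intro half[of 0 b c]) (auto simp: u_def v_def algebra_simps)
  next
    case gt: False
    have uv: "\<bar>u\<bar> \<le> pi" "\<bar>v\<bar> \<le> pi" using b c by (auto simp: u_def v_def)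
    \<comment> \<open>Here \<open>\<bar>u - v\<bar>\<close> lies between \<open>pi\<close> and
      \<open>3 * pi / 2\<close>.\<close>
    have le: "cos (u - v) \<le> 0" if "\<bar>u\<bar> \<le> pi / 2 \<or> \<bar>v\<bar> \<le> pi / 2"
      by (rule cos_nonpos_of_ge) (use that uv gt pi_gt_zero in linarith)+
    consider "\<bar>u\<bar> > pi / 2" "\<bar>v\<bar> > pi / 2" | "\<bar>u\<bar> \<le> pi / 2" | "\<bar>v\<bar> \<le> pi / 2" by linarith
    then show ?thesis
    proof cases
      case 1
      then have "\<bar>u\<bar> < 3 * pi / 2" "\<bar>v\<bar> < 3 * pi / 2" using uv pi_gt_zero by linarith+
      with 1 have "cos u < 0" "cos v < 0" by (auto intro!: cos_neg_of_gt)
      then show ?thesis using r by (intro opp0) (auto simp: cu cv intro!: sum_neg(1))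
    next
      case 2
      then have "pi / 2 < \<bar>v\<bar>" "\<bar>v\<bar> < 3 * pi / 2" using uv gt pi_gt_zero by linarith+
      then have "cos (u - v) \<le> 0" "cos v < 0"
        using le 2 by (auto intro!: cos_neg_of_gt)
      then show ?thesis using r by (intro opp2) (auto simp: cw cv intro!: sum_neg(1))
    next
      case 3
      then have "pi / 2 < \<bar>u\<bar>" "\<bar>u\<bar> < 3 * pi / 2" using uv gt pi_gt_zero by linarith+
      then have "cos (u - v) \<le> 0" "cos u < 0"
        using le 3 by (auto intro!: cos_neg_of_gt)
      then show ?thesis using r by (intro opp1) (auto simp: cw cu intro!: sum_neg(2))
    qed
  qed
qed


section \<open>The commensurable case\<close>

text \<open>The turn moves \<open>s\<close> by \<open>pi - \<bar>c\<bar>\<close> up or down, from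
  \<open>pi\<close> to \<open>2 * pi - \<bar>c\<bar>\<close> or to \<open>\<bar>c\<bar>\<close>. The
  direction is dictated by the gain in modulus, hence the disjunction.\<close>

lemma cong_turn:
  fixes n :: int
  assumes s: "[s = pi] (rmod 2 * pi)" and n: "n \<noteq> 0"
    and x: "x = (pi - \<bar>c\<bar>) / \<bar>of_int n\<bar> \<or> x = - ((pi - \<bar>c\<bar>) / \<bar>of_int n\<bar>)"
  shows "[s + of_int n * x = c] (rmod 2 * pi) \<or> [s + of_int n * x = - c] (rmod 2 * pi)"
proof -
  from s obtain k :: int where k: "s = pi + of_int k * (2 * pi)"
    by (auto simp: rcong_iff_diff_multiple algebra_simps)
  have "of_int n * x = pi - \<bar>c\<bar> \<or> of_int n * x = - (pi - \<bar>c\<bar>)"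
    using x n by (auto simp: abs_if)
  then have "s + of_int n * x = - \<bar>c\<bar> + of_int (k + 1) * (2 * pi) \<or>
      s + of_int n * x = \<bar>c\<bar> + of_int k * (2 * pi)"
    using k by (auto simp: algebra_simps)
  then have "[s + of_int n * x = - \<bar>c\<bar>] (rmod 2 * pi) \<or> [s + of_int n * x = \<bar>c\<bar>] (rmod 2 * pi)"
    unfolding rcong_iff_diff_multiple by (metis add_diff_cancel_left')
  then show ?thesis by (auto simp: abs_if split: if_splits)
qed

locale commensurable_trinomial =
  fixes l0 l1 l2 r0 r1 r2 d :: real and m1 m2 p1 p2 :: int
  assumes r: "r0 > 0" "r1 > 0" "r2 > 0"
    and d: "d \<noteq> 0"
    and l: "l1 - l0 = of_int m1 * d" "l2 - l0 = of_int m2 * d"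
    and m: "m1 \<noteq> 0" "m2 \<noteq> 0" "m1 \<noteq> m2"
    and bezout: "p1 * m1 + p2 * m2 = 1"
begin

text \<open>\<open>d * J\<close> is the linear form of the congruence. Its coefficients sum to zero
  and are orthogonal to \<open>(l0, l1, l2)\<close>, so common rotations and the flow preserve
  \<open>J\<close>; being integers, they let full turns change it by multiples of
  \<open>2 * pi\<close> only.\<close>

definition J :: "real \<Rightarrow> real \<Rightarrow> real \<Rightarrow> real" where
  "J y0 y1 y2 = of_int (m2 - m1) * y0 + of_int (- m2) * y1 + of_int m1 * y2"

abbreviation M where "M \<equiv> trinomial_sup l0 l1 l2 r0 r1 r2"
abbreviation F where "F \<equiv> trimod r0 r1 r2"

lemma trimod_greater:
  assumes y: "[J y0 y1 y2 = pi] (rmod 2 * pi)" and c: "\<bar>c\<bar> < pi"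
  obtains z0 z1 z2 where "[J z0 z1 z2 = c] (rmod 2 * pi) \<or> [J z0 z1 z2 = - c] (rmod 2 * pi)"
    "F y0 y1 y2 < F z0 z1 z2"
proof -
  \<comment> \<open>The turning angle is admissible for \<open>trimod_turn_less\<close>, since a
    nonzero integer has absolute value at least 1.\<close>
  have h: "0 < (pi - \<bar>c\<bar>) / \<bar>real_of_int n\<bar>" "(pi - \<bar>c\<bar>) / \<bar>real_of_int n\<bar> \<le> pi" if "n \<noteq> 0" for n
  proof -
    have n: "\<bar>real_of_int n\<bar> \<ge> 1" using that by linarith
    then show "0 < (pi - \<bar>c\<bar>) / \<bar>real_of_int n\<bar>" using c by simp
    have "pi - \<bar>c\<bar> \<le> pi * 1" by simp
    also have "\<dots> \<le> pi * \<bar>real_of_int n\<bar>" using n by (intro mult_left_mono) auto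
    finally show "(pi - \<bar>c\<bar>) / \<bar>real_of_int n\<bar> \<le> pi" using n by (simp add: divide_le_eq)
  qed
  show ?thesis
  proof (rule half_circle_or_opposed[OF r, of y0 y1 y2])
    fix a0 a1 a2 :: int
    assume half: "\<bar>(y0 + 2 * pi * of_int a0) - (y1 + 2 * pi * of_int a1)\<bar> \<le> pi"
      "\<bar>(y1 + 2 * pi * of_int a1) - (y2 + 2 * pi * of_int a2)\<bar> \<le> pi"
      "\<bar>(y0 + 2 * pi * of_int a0) - (y2 + 2 * pi * of_int a2)\<bar> \<le> pi"
    define z0 z1 z2 where z: "z0 = y0 + 2 * pi * of_int a0" "z1 = y1 + 2 * pi * of_int a1"
      "z2 = y2 + 2 * pi * of_int a2"
    \<comment> \<open>\<open>J\<close> is linear, so this factor brings it exactly to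
      \<open>c\<close>.\<close>
    define s where "s = c / J z0 z1 z2"
    from y obtain k :: int where k: "J y0 y1 y2 = pi + of_int k * (2 * pi)"
      by (auto simp: rcong_iff_diff_multiple algebra_simps)
    have Jz: "J z0 z1 z2 = pi * of_int (1 + 2 * (k + (m2 - m1) * a0 - m2 * a1 + m1 * a2))"
      using k by (simp add: J_def z algebra_simps)
    \<comment> \<open>An odd integer is nonzero, so
      \<open>\<bar>J z0 z1 z2\<bar> \<ge> pi > \<bar>c\<bar>\<close>; this gives
      \<open>\<bar>s\<bar> < 1\<close> and also excludes three equal angles, where \<open>J\<close>
      would vanish.\<close>
    have "odd (1 + 2 * (k + (m2 - m1) * a0 - m2 * a1 + m1 * a2))" by simp
    then have "1 + 2 * (k + (m2 - m1) * a0 - m2 * a1 + m1 * a2) \<noteq> 0" by (metis even_zero)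
    then have "\<bar>real_of_int (1 + 2 * (k + (m2 - m1) * a0 - m2 * a1 + m1 * a2))\<bar> \<ge> 1" by linarith
    then have ge: "\<bar>J z0 z1 z2\<bar> \<ge> pi" unfolding Jz abs_mult by simp
    have Jne: "J z0 z1 z2 \<noteq> 0" using ge pi_gt_zero by linarith
    have "F z0 z1 z2 < F (s * z0) (s * z1) (s * z2)"
    proof (rule trimod_scale_less[OF r])
      show "\<bar>s\<bar> < 1" using ge c by (simp add: s_def)
      show "\<not> (z0 = z1 \<and> z1 = z2)" using Jne by (auto simp: J_def algebra_simps)
    qed (use half in \<open>simp_all add: z\<close>)
    moreover have "J (s * z0) (s * z1) (s * z2) = s * J z0 z1 z2" by (simp add: J_def algebra_simps)
    then have "J (s * z0) (s * z1) (s * z2) = c" using Jne by (simp add: s_def)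
    ultimately show ?thesis
      by (intro that[of "s * z0" "s * z1" "s * z2"]) (auto simp: z trimod_periodic)
  next
    assume opp0: "r1 * cos (y0 - y1) + r2 * cos (y0 - y2) < 0"
    have n: "m2 - m1 \<noteq> 0" using m by simp
    obtain x where x: "x = (pi - \<bar>c\<bar>) / \<bar>of_int (m2 - m1)\<bar> \<or> x = - ((pi - \<bar>c\<bar>) / \<bar>of_int (m2 - m1)\<bar>)"
      and lt: "F y0 y1 y2 < F (y0 + x) y1 y2"
      using trimod_turn_less[OF r(1) opp0 h[OF n]] by blast
    have "J (y0 + x) y1 y2 = J y0 y1 y2 + of_int (m2 - m1) * x" by (simp add: J_def algebra_simps)
    with cong_turn[OF y n x] lt show ?thesis by (intro that[of "y0 + x" y1 y2]) simp_all
  next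
    assume opp1: "r2 * cos (y1 - y2) + r0 * cos (y1 - y0) < 0"
    have n: "- m2 \<noteq> 0" using m by simp
    obtain x where x: "x = (pi - \<bar>c\<bar>) / \<bar>of_int (- m2)\<bar> \<or> x = - ((pi - \<bar>c\<bar>) / \<bar>of_int (- m2)\<bar>)"
      and lt: "F y0 y1 y2 < F y0 (y1 + x) y2"
      using trimod_turn_less[OF r(2) opp1 h[OF n]] unfolding trimod_rotate[of r0] by blast
    have "J y0 (y1 + x) y2 = J y0 y1 y2 + of_int (- m2) * x" by (simp add: J_def algebra_simps)
    with cong_turn[OF y n x] lt show ?thesis by (intro that[of y0 "y1 + x" y2]) simp_all
  next
    assume opp2: "r0 * cos (y2 - y0) + r1 * cos (y2 - y1) < 0"
    obtain x where x: "x = (pi - \<bar>c\<bar>) / \<bar>of_int m1\<bar> \<or> x = - ((pi - \<bar>c\<bar>) / \<bar>of_int m1\<bar>)"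
      and lt: "F y0 y1 y2 < F y0 y1 (y2 + x)"
      using trimod_turn_less[OF r(3) opp2 h[OF m(1)]] unfolding trimod_rotate[of r2] by blast
    have "J y0 y1 (y2 + x) = J y0 y1 y2 + of_int m1 * x" by (simp add: J_def algebra_simps)
    with cong_turn[OF y m(1) x] lt show ?thesis by (intro that[of y0 y1 "y2 + x"]) simp_all
  qed
qed

text \<open>A level set of \<open>J\<close> is a plane spanned by the common rotation and the flow,
  so equal values of \<open>J\<close> mean reachability; congruent values are first made equal by
  full turns.\<close>

lemma trimod_le_sup_of_cong:
  assumes "[J y0 y1 y2 = J t0 t1 t2] (rmod 2 * pi)"
  shows "F y0 y1 y2 \<le> M t0 t1 t2"
proof -
  from assms obtain k :: int where k: "J y0 y1 y2 - J t0 t1 t2 = of_int k * (2 * pi)"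
    by (auto simp: rcong_iff_diff_multiple)
  \<comment> \<open>These full turns lower \<open>J\<close> by
    \<open>2 * pi * k * (p1 * m1 + p2 * m2)\<close>, which is \<open>2 * pi * k\<close> by
    Bezout.\<close>
  define z1 z2 where "z1 = y1 + 2 * pi * of_int (k * p2)" and "z2 = y2 + 2 * pi * of_int (- (k * p1))"
  \<comment> \<open>The time \<open>t\<close> matches the difference of the first two angles and the
    rotation \<open>a\<close> matches the angle \<open>y0\<close>; equality of \<open>J\<close> then
    forces the third angle.\<close>
  define t where "t = ((z1 - t1) - (y0 - t0)) / (l1 - l0)"
  define a where "a = y0 - t0 - l0 * t"
  have ne: "l1 - l0 \<noteq> 0" using l m d by simp
  have "J y0 z1 z2 = J y0 y1 y2 - 2 * pi * of_int k * of_int (p1 * m1 + p2 * m2)"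
    by (simp add: J_def z1_def z2_def algebra_simps)
  then have "J y0 z1 z2 = J t0 t1 t2" unfolding bezout using k by (simp add: algebra_simps)
  then have "of_int m1 * ((z2 - t2) - (y0 - t0)) = of_int m2 * ((z1 - t1) - (y0 - t0))"
    by (simp add: J_def algebra_simps)
  also have "(z1 - t1) - (y0 - t0) = of_int m1 * d * t" using ne by (simp add: t_def flip: l)
  finally have "of_int m1 * ((z2 - t2) - (y0 - t0)) = of_int m1 * ((of_int m2 * d) * t)"
    by (simp add: algebra_simps)
  then have "(z2 - t2) - (y0 - t0) = (of_int m2 * d) * t" using m(1) by simp
  then have "y0 = a + (t0 + l0 * t)" "z2 = a + (t2 + l2 * t)"
    using l by (simp_all add: a_def algebra_simps)
  moreover have "(l1 - l0) * t = (z1 - t1) - (y0 - t0)" using ne by (simp add: t_def)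
  then have "z1 = a + (t1 + l1 * t)" by (simp add: a_def algebra_simps)
  ultimately have "F y0 z1 z2 = F (t0 + l0 * t) (t1 + l1 * t) (t2 + l2 * t)"
    by (metis trimod_shift)
  moreover have "F y0 z1 z2 = F y0 y1 y2"
    using trimod_periodic[of r0 r1 r2 y0 0 y1 "k * p2" y2 "- (k * p1)"] by (simp add: z1_def z2_def)
  ultimately show ?thesis using trimod_le_sup[OF r] by metis
qed

text \<open>Complex conjugation negates all angles, hence \<open>J\<close>, and keeps the
  modulus.\<close>

lemma trimod_le_sup_of_cong_minus:
  assumes "[J y0 y1 y2 = - J t0 t1 t2] (rmod 2 * pi)"
  shows "F y0 y1 y2 \<le> M t0 t1 t2"
proof -
  have "J (- y0) (- y1) (- y2) = - J y0 y1 y2" by (simp add: J_def)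
  then have "[J (- y0) (- y1) (- y2) = J t0 t1 t2] (rmod 2 * pi)"
    using rcong_uminus[OF assms] by simp
  from trimod_le_sup_of_cong[OF this] show ?thesis by (simp add: trimod_minus)
qed

lemma J_flow: "J (t0 + l0 * t) (t1 + l1 * t) (t2 + l2 * t) = J t0 t1 t2"
proof -
  have "l1 = l0 + of_int m1 * d" "l2 = l0 + of_int m2 * d" using l by simp_all
  then show ?thesis by (simp add: J_def algebra_simps)
qed

text \<open>The modulus is continuous and periodic along the flow, so a compact interval of one
  period suffices. Attainment is what turns a pointwise gain into a strict inequality of
  suprema.\<close>

lemma sup_attained:
  obtains y0 y1 y2 where "J y0 y1 y2 = J t0 t1 t2" "M t0 t1 t2 = F y0 y1 y2"
proof -
  define f where "f t = F (t0 + l0 * t) (t1 + l1 * t) (t2 + l2 * t)" for t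
  \<comment> \<open>After time \<open>T\<close> all three terms have turned by \<open>l0 * T\<close>
    up to full turns. As \<open>d\<close> may be negative, the period interval below uses
    \<open>\<bar>T\<bar>\<close>.\<close>
  define T where "T = 2 * pi / d"
  have T: "l1 * T = l0 * T + 2 * pi * of_int m1" "l2 * T = l0 * T + 2 * pi * of_int m2"
    using l d by (simp_all add: T_def field_simps)
  have per: "f (t + T * of_int j) = f t" for t j
  proof -
    have "f (t + T * of_int j) = F (of_int j * (l0 * T) + (t0 + l0 * t))
        (of_int j * (l1 * T) + (t1 + l1 * t)) (of_int j * (l2 * T) + (t2 + l2 * t))"
      by (simp add: f_def algebra_simps)
    also have "\<dots> = F (of_int j * (l0 * T) + (t0 + l0 * t + 2 * pi * of_int 0))
        (of_int j * (l0 * T) + (t1 + l1 * t + 2 * pi * of_int (j * m1)))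
        (of_int j * (l0 * T) + (t2 + l2 * t + 2 * pi * of_int (j * m2)))"
      unfolding T by (simp add: algebra_simps)
    also have "\<dots> = f t" unfolding trimod_shift trimod_periodic f_def ..
    finally show ?thesis .
  qed
  have "continuous_on {0..\<bar>T\<bar>} f"
    unfolding f_def trimod_def cis_conv_exp by (intro continuous_intros)
  then obtain s where s: "\<And>t. t \<in> {0..\<bar>T\<bar>} \<Longrightarrow> f t \<le> f s"
    using continuous_attains_sup[of "{0..\<bar>T\<bar>}" f] by fastforce
  have "f t \<le> f s" for t
  proof -
    have T0: "\<bar>T\<bar> > 0" using d by (simp add: T_def)
    define j where "j = \<lfloor>t / \<bar>T\<bar>\<rfloor>"
    have "of_int j * \<bar>T\<bar> \<le> t" "t \<le> (of_int j + 1) * \<bar>T\<bar>"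
      using floor_divide_lower[OF T0, of t] floor_divide_upper[OF T0, of t] unfolding j_def
      by simp_all
    then have "t - \<bar>T\<bar> * of_int j \<in> {0..\<bar>T\<bar>}" by (simp add: algebra_simps)
    moreover have "f (t - \<bar>T\<bar> * of_int j) = f t"
      using per[of t j] per[of t "- j"] by (cases "T \<ge> 0") simp_all
    ultimately show ?thesis using s by metis
  qed
  then have "M t0 t1 t2 = f s"
    unfolding trinomial_sup_eq f_def by (intro cSup_eq_maximum) auto
  then show ?thesis using that J_flow unfolding f_def by metis
qed

text \<open>A maximizer for the phases \<open>t0\<close>, \<open>t1\<close>, \<open>t2\<close> is
  improved to angles whose \<open>J\<close> is congruent to plus or minus \<open>J s0 s1 s2\<close>;
  these bound the other supremum from below.\<close>

lemma sup_less:
  assumes "[J t0 t1 t2 = pi] (rmod 2 * pi)" "\<not> [J s0 s1 s2 = pi] (rmod 2 * pi)"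
  shows "M t0 t1 t2 < M s0 s1 s2"
proof -
  obtain y0 y1 y2 where y: "J y0 y1 y2 = J t0 t1 t2" "M t0 t1 t2 = F y0 y1 y2"
    by (rule sup_attained)
  obtain j :: int where j: "- pi < J s0 s1 s2 + 2 * pi * of_int j" "J s0 s1 s2 + 2 * pi * of_int j \<le> pi"
    by (rule reduce_mod_2pi)
  define c where "c = J s0 s1 s2 + 2 * pi * of_int j"
  have c: "[c = J s0 s1 s2] (rmod 2 * pi)"
    unfolding rcong_iff_diff_multiple by (auto simp: c_def)
  have "c \<noteq> pi" using assms(2) c rcong_sym by blast
  then have "\<bar>c\<bar> < pi" using j by (auto simp: c_def)
  then obtain z0 z1 z2 where
    z: "[J z0 z1 z2 = c] (rmod 2 * pi) \<or> [J z0 z1 z2 = - c] (rmod 2 * pi)"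
    and lt: "F y0 y1 y2 < F z0 z1 z2"
    using trimod_greater[of y0 y1 y2 c] assms(1) y(1) by metis
  from z have "F z0 z1 z2 \<le> M s0 s1 s2"
  proof
    assume "[J z0 z1 z2 = c] (rmod 2 * pi)"
    from rcong_trans[OF this c] show ?thesis by (rule trimod_le_sup_of_cong)
  next
    assume "[J z0 z1 z2 = - c] (rmod 2 * pi)"
    from rcong_trans[OF this rcong_uminus[OF c]] show ?thesis by (rule trimod_le_sup_of_cong_minus)
  qed
  with lt y show ?thesis by simp
qed

lemma minimizing_iff:
  "minimizing_phases l0 l1 l2 r0 r1 r2 t0 t1 t2 \<longleftrightarrow> [J t0 t1 t2 = pi] (rmod 2 * pi)"
proof
  assume min: "minimizing_phases l0 l1 l2 r0 r1 r2 t0 t1 t2"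
  show "[J t0 t1 t2 = pi] (rmod 2 * pi)"
  proof (rule ccontr)
    assume "\<not> [J t0 t1 t2 = pi] (rmod 2 * pi)"
    \<comment> \<open>One triple in the class of \<open>pi\<close> is enough to contradict
      minimality.\<close>
    moreover have "J 0 0 (pi / of_int m1) = pi" using m by (simp add: J_def)
    ultimately have "M 0 0 (pi / of_int m1) < M t0 t1 t2" by (intro sup_less) simp_all
    with min show False unfolding minimizing_phases_def by (meson not_le)
  qed
next
  assume t: "[J t0 t1 t2 = pi] (rmod 2 * pi)"
  show "minimizing_phases l0 l1 l2 r0 r1 r2 t0 t1 t2"
    unfolding minimizing_phases_def
  proof (intro allI)
    fix s0 s1 s2
    show "M t0 t1 t2 \<le> M s0 s1 s2"
    proof (cases "[J s0 s1 s2 = pi] (rmod 2 * pi)")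
      case False
      with sup_less[OF t] show ?thesis by (auto intro: less_imp_le)
    next
      case True
      obtain y0 y1 y2 where y: "J y0 y1 y2 = J t0 t1 t2" "M t0 t1 t2 = F y0 y1 y2"
        by (rule sup_attained)
      \<comment> \<open>Both triples lie in the class of \<open>pi\<close>, so the maximizer for one
        is reached, up to rotation, from the other.\<close>
      have "[J y0 y1 y2 = J s0 s1 s2] (rmod 2 * pi)"
        using y(1) t True rcong_sym rcong_trans by metis
      from trimod_le_sup_of_cong[OF this] y show ?thesis by simp
    qed
  qed
qed

text \<open>By Bezout \<open>m1\<close> or \<open>m2\<close> is odd; a phase \<open>pi\<close> at an
  angle with odd coefficient in \<open>J\<close>, and 0 elsewhere, makes \<open>J\<close> an odd
  multiple of \<open>pi\<close>.\<close>

lemma ex_minimizing: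
  "\<exists>t0\<in>{0, pi}. \<exists>t1\<in>{0, pi}. \<exists>t2\<in>{0, pi}. minimizing_phases l0 l1 l2 r0 r1 r2 t0 t1 t2"
proof (cases "odd m1")
  case True
  then obtain k where "m1 = 2 * k + 1" by (rule oddE)
  then have "real_of_int m1 = 2 * of_int k + 1" by simp
  then have "J 0 0 pi - pi = of_int k * (2 * pi)" by (simp add: J_def algebra_simps)
  then show ?thesis unfolding minimizing_iff rcong_iff_diff_multiple by blast
next
  case False
  have "odd (- m2)"
  proof
    assume "even (- m2)"
    with False have "even (p1 * m1 + p2 * m2)" by simp
    then show False unfolding bezout by simp
  qed
  then obtain k where "- m2 = 2 * k + 1" by (rule oddE)
  then have "real_of_int (- m2) = 2 * of_int k + 1" by simp
  then have "J 0 pi 0 - pi = of_int k * (2 * pi)" by (simp add: J_def algebra_simps)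
  then show ?thesis unfolding minimizing_iff rcong_iff_diff_multiple by blast
qed

lemma cong_iff:
  "[t0 * (l2 - l1) + t1 * (l0 - l2) + t2 * (l1 - l0) = d * pi] (rmod (2 * d * pi))
    \<longleftrightarrow> [J t0 t1 t2 = pi] (rmod 2 * pi)"
proof -
  have "l1 = l0 + of_int m1 * d" "l2 = l0 + of_int m2 * d" using l by simp_all
  then have "t0 * (l2 - l1) + t1 * (l0 - l2) + t2 * (l1 - l0) = d * J t0 t1 t2"
    by (simp add: J_def algebra_simps)
  moreover have "d * J t0 t1 t2 - d * pi = of_int k * (2 * d * pi) \<longleftrightarrow> J t0 t1 t2 - pi = of_int k * (2 * pi)"
    for k
  proof -
    have "d * J t0 t1 t2 - d * pi = of_int k * (2 * d * pi) \<longleftrightarrow>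
        d * (J t0 t1 t2 - pi) = d * (of_int k * (2 * pi))" by (simp add: algebra_simps)
    then show ?thesis using d by simp
  qed
  ultimately show ?thesis by (simp add: rcong_iff_diff_multiple)
qed

end

section \<open>Finitely generated and discrete subgroups of the real line\<close>

lemma group_closure_of_int_mult:
  fixes x :: real
  assumes "x \<in> group_closure S"
  shows "of_int k * x \<in> group_closure S"
proof (cases k rule: int_cases2)
  case (nonneg n)
  with group_closure_scalar_mult_left[OF assms, of n] show ?thesis by simp
next
  case (nonpos n)
  with group_closure_scalar_mult_left[OF assms, of n] show ?thesis by simp
qed

lemma group_closure_pair:
  fixes a b :: real
  shows "group_closure {a, b} = range (\<lambda>(m :: int, n :: int). of_int m * a + of_int n * b)"
    (is "_ = ?R")
proof
  show "group_closure {a, b} \<subseteq> ?R"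
  proof (rule group_closure_least)
    have "a \<in> ?R" by (rule image_eqI[of _ _ "(1, 0)"]) simp_all
    moreover have "b \<in> ?R" by (rule image_eqI[of _ _ "(0, 1)"]) simp_all
    ultimately show "{a, b} \<subseteq> ?R" by simp
    show "0 \<in> ?R" by (rule image_eqI[of _ _ "(0, 0)"]) simp_all
    show "x - y \<in> ?R" if xy: "x \<in> ?R" "y \<in> ?R" for x y
    proof -
      obtain m n m' n' :: int where "x = of_int m * a + of_int n * b" "y = of_int m' * a + of_int n' * b"
        using xy by auto
      then show ?thesis by (intro image_eqI[of _ _ "(m - m', n - n')"]) (auto simp: algebra_simps)
    qed
  qed
  have "a \<in> group_closure {a, b}" "b \<in> group_closure {a, b}" by (auto intro: group_closure.base)
  then show "?R \<subseteq> group_closure {a, b}"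
    by (auto intro: group_closure_add group_closure_of_int_mult)
qed

lemma group_closure_single:
  fixes d :: real
  shows "group_closure {d} = range (\<lambda>m :: int. of_int m * d)" (is "_ = ?R")
proof
  show "group_closure {d} \<subseteq> ?R"
  proof (rule group_closure_least)
    have "d \<in> ?R" by (rule image_eqI[of _ _ 1]) simp_all
    then show "{d} \<subseteq> ?R" by simp
    show "0 \<in> ?R" by (rule image_eqI[of _ _ 0]) simp_all
    show "x - y \<in> ?R" if "x \<in> ?R" "y \<in> ?R" for x y
      using that by (auto simp flip: left_diff_distrib of_int_diff)
  qed
  have "d \<in> group_closure {d}" by (auto intro: group_closure.base)
  then show "?R \<subseteq> group_closure {d}"
    by (auto intro: group_closure_of_int_mult)
qed

text \<open>Arbitrarily small positive elements would have multiples near every real. Otherwise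
  there is a least positive element, and division with remainder shows that it generates.\<close>

lemma group_closure_dense_or_cyclic:
  fixes S :: "real set"
  assumes a: "a \<in> S" "a \<noteq> 0" and nd: "closure (group_closure S) \<noteq> UNIV"
  obtains d where "d > 0" "group_closure S = group_closure {d}"
proof -
  let ?G = "group_closure S"
  have "\<exists>e>0. \<forall>g\<in>?G. 0 < g \<longrightarrow> e \<le> g"
  proof (rule ccontr)
    assume "\<not> ?thesis"
    then have small: "\<exists>g\<in>?G. 0 < g \<and> g < e" if "e > 0" for e
      using that by (meson not_le)
    have "x \<in> closure ?G" for x
      unfolding closure_approachable
    proof (intro allI impI)
      fix e :: real assume "e > 0"
      then obtain g where g: "g \<in> ?G" "0 < g" "g < e" using small by blast
      have "of_int \<lfloor>x / g\<rfloor> * g \<le> x" "x < (of_int \<lfloor>x / g\<rfloor> + 1) * g"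
        using floor_divide_lower[OF g(2), of x] floor_divide_upper[OF g(2), of x] by simp_all
      then have "dist (of_int \<lfloor>x / g\<rfloor> * g) x < e"
        using g by (simp add: dist_real_def algebra_simps)
      then show "\<exists>y\<in>?G. dist y x < e" using group_closure_of_int_mult[OF g(1)] by blast
    qed
    with nd show False by auto
  qed
  then obtain e where e: "e > 0" "\<And>g. g \<in> ?G \<Longrightarrow> 0 < g \<Longrightarrow> e \<le> g" by blast
  have "\<bar>a\<bar> \<in> ?G \<and> 0 < \<bar>a\<bar>" using a by (auto simp: abs_if intro: group_closure.base)
  \<comment> \<open>Distinct elements differ by at least \<open>e\<close>, so a smaller positive
    element would have a smaller \<open>\<lfloor>g / e\<rfloor>\<close>; minimizing this natural
    number therefore finds the least positive element.\<close>
  then obtain d where d: "d \<in> ?G" "0 < d"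
    and min: "\<And>g. g \<in> ?G \<and> 0 < g \<Longrightarrow> nat \<lfloor>d / e\<rfloor> \<le> nat \<lfloor>g / e\<rfloor>"
    using ex_has_least_nat[of "\<lambda>g. g \<in> ?G \<and> 0 < g" _ "\<lambda>g. nat \<lfloor>g / e\<rfloor>"] by blast
  have least: "d \<le> g" if g: "g \<in> ?G" "0 < g" for g
  proof (rule ccontr)
    assume "\<not> d \<le> g"
    then have "e \<le> d - g" using e(2)[of "d - g"] d g by (simp add: group_closure.diff)
    then have "(g + e) / e \<le> d / e" using e(1) by (intro divide_right_mono) simp_all
    then have "g / e + 1 \<le> d / e" using e(1) by (simp add: add_divide_distrib)
    then have "\<lfloor>g / e\<rfloor> + 1 \<le> \<lfloor>d / e\<rfloor>" by linarith
    moreover have "0 \<le> \<lfloor>g / e\<rfloor>" using g e(1) by simp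
    ultimately show False using min[of g] g by linarith
  qed
  have "?G = group_closure {d}"
  proof
    show "?G \<subseteq> group_closure {d}"
    proof
      fix x assume x: "x \<in> ?G"
      define y where "y = x - of_int \<lfloor>x / d\<rfloor> * d"
      have "y \<in> ?G" unfolding y_def by (intro group_closure.diff x group_closure_of_int_mult d)
      moreover have "0 \<le> y" "y < d"
        using floor_divide_lower[OF d(2), of x] floor_divide_upper[OF d(2), of x]
        by (simp_all add: y_def algebra_simps)
      ultimately have "y = 0" using least[of y] by fastforce
      then show "x \<in> group_closure {d}" unfolding group_closure_single y_def by auto
    qed
    show "group_closure {d} \<subseteq> ?G"
      unfolding group_closure_single using group_closure_of_int_mult[OF d(1)] by blast
  qed
  with d show ?thesis using that by blast
qed

section \<open>The dense case\<close>

text \<open>The first two terms are aligned exactly and the third approximately, by density;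
  continuity of the modulus then gives the lower bound.\<close>

lemma trinomial_sup_dense:
  assumes r: "r0 > 0" "r1 > 0" "r2 > 0" and ne: "l0 \<noteq> l1"
    and dense: "closure (group_closure {l1 - l0, l2 - l0}) = UNIV"
  shows "trinomial_sup l0 l1 l2 r0 r1 r2 \<theta>0 \<theta>1 \<theta>2 = r0 + r1 + r2"
proof (rule antisym)
  show "trinomial_sup l0 l1 l2 r0 r1 r2 \<theta>0 \<theta>1 \<theta>2 \<le> r0 + r1 + r2"
    unfolding trinomial_sup_eq by (rule cSUP_least) (auto intro: trimod_le r)
  define a b where "a = l1 - l0" and "b = l2 - l0"
  define f where "f x = trimod r0 r1 r2 0 0 x" for x
  have a: "a \<noteq> 0" using ne by (simp add: a_def)
  \<comment> \<open>The times with \<open>\<theta>0 + l0 * t\<close> and \<open>\<theta>1 + l1 * t\<close> congruent modulo \<open>2 * pi\<close> are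
     \<open>t = (\<theta>0 - \<theta>1 + 2 * pi * m) / a\<close>; at these the third angle lags by \<open>2 * pi / a\<close> times
     the distance of an element of the group to a fixed target.\<close>
  define z where "z = (b * (\<theta>1 - \<theta>0) + a * (\<theta>0 - \<theta>2)) / (2 * pi)"
  have "z \<in> closure (group_closure {a, b})" using dense by (simp add: a_def b_def)
  then obtain g where g: "\<And>n. g n \<in> group_closure {a, b}" "g \<longlonglongrightarrow> z"
    unfolding closure_sequential by blast
  have le: "f (2 * pi / a * (g n - z)) \<le> trinomial_sup l0 l1 l2 r0 r1 r2 \<theta>0 \<theta>1 \<theta>2" for n
  proof -
    obtain k m :: int where km: "g n = of_int k * a + of_int m * b"
      using g(1)[of n] unfolding group_closure_pair by auto
    define t where "t = (\<theta>0 - \<theta>1 + 2 * pi * of_int m) / a"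
    have at: "a * t = \<theta>0 - \<theta>1 + 2 * pi * of_int m" using a by (simp add: t_def)
    \<comment> \<open>The part \<open>k * a\<close> of \<open>g n\<close> contributes full turns;
      the part \<open>m * b\<close> combines with the \<open>\<theta>1 - \<theta>0\<close> part of
      \<open>z\<close> to \<open>b * t\<close>.\<close>
    have "2 * pi / a * (g n - z) = 2 * pi * of_int k + b * t + \<theta>2 - \<theta>0"
      using a by (simp add: km z_def t_def field_simps)
    then have "f (2 * pi / a * (g n - z)) = trimod r0 r1 r2 ((\<theta>0 + l0 * t) + 0)
        ((\<theta>0 + l0 * t) + 0) ((\<theta>0 + l0 * t) + (2 * pi * of_int k + b * t + \<theta>2 - \<theta>0))"
      unfolding f_def trimod_shift by simp
    also have "\<dots> = trimod r0 r1 r2 (\<theta>0 + l0 * t + 2 * pi * of_int 0)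
        (\<theta>1 + l1 * t + 2 * pi * of_int (- m)) (\<theta>2 + l2 * t + 2 * pi * of_int k)"
      using at by (simp add: a_def b_def algebra_simps)
    also have "\<dots> \<le> trinomial_sup l0 l1 l2 r0 r1 r2 \<theta>0 \<theta>1 \<theta>2"
      unfolding trimod_periodic by (rule trimod_le_sup[OF r])
    finally show ?thesis .
  qed
  have "continuous_on UNIV f" unfolding f_def trimod_def cis_conv_exp by (intro continuous_intros)
  moreover have "(\<lambda>n. 2 * pi / a * (g n - z)) \<longlonglongrightarrow> 2 * pi / a * (z - z)"
    by (intro tendsto_intros g)
  ultimately have "(\<lambda>n. f (2 * pi / a * (g n - z))) \<longlonglongrightarrow> f (2 * pi / a * (z - z))"
    by (auto intro: continuous_on_tendsto_compose)
  moreover have "f (2 * pi / a * (z - z)) = r0 + r1 + r2"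
    using r by (simp add: f_def trimod_def norm_of_real flip: of_real_add)
  ultimately have "(\<lambda>n. f (2 * pi / a * (g n - z))) \<longlonglongrightarrow> r0 + r1 + r2" by simp
  then show "r0 + r1 + r2 \<le> trinomial_sup l0 l1 l2 r0 r1 r2 \<theta>0 \<theta>1 \<theta>2"
    by (rule LIMSEQ_le_const2) (use le in blast)
qed

theorem theorem3p3:
  fixes l0 l1 l2 r0 r1 r2 :: real and G :: "real set"
  assumes distinct: "l0 \<noteq> l1" "l0 \<noteq> l2" "l1 \<noteq> l2"
    and pos: "r0 > 0" "r1 > 0" "r2 > 0"
    and G: "G = group_closure {l1 - l0, l2 - l0}"
  shows "(closure G = UNIV \<longrightarrow>
           (\<forall>\<theta>0 \<theta>1 \<theta>2. trinomial_sup l0 l1 l2 r0 r1 r2 \<theta>0 \<theta>1 \<theta>2 = r0 + r1 + r2))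
       \<and> (closure G \<noteq> UNIV \<longrightarrow>
           (\<exists>d>0. G = group_closure {d})
         \<and> (\<forall>d. G = group_closure {d} \<longrightarrow>
              (\<forall>\<theta>0 \<theta>1 \<theta>2. minimizing_phases l0 l1 l2 r0 r1 r2 \<theta>0 \<theta>1 \<theta>2 \<longleftrightarrow>
                 [\<theta>0 * (l2 - l1) + \<theta>1 * (l0 - l2) + \<theta>2 * (l1 - l0) = d * pi] (rmod (2 * d * pi))))
         \<and> (\<exists>\<theta>0\<in>{0, pi}. \<exists>\<theta>1\<in>{0, pi}. \<exists>\<theta>2\<in>{0, pi}.
              minimizing_phases l0 l1 l2 r0 r1 r2 \<theta>0 \<theta>1 \<theta>2))"
proof (intro conjI impI)
  assume "closure G = UNIV"
  then show "\<forall>\<theta>0 \<theta>1 \<theta>2. trinomial_sup l0 l1 l2 r0 r1 r2 \<theta>0 \<theta>1 \<theta>2 = r0 + r1 + r2"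
    using trinomial_sup_dense[OF pos distinct(1)] G by blast
next
  assume nd: "closure G \<noteq> UNIV"
  then obtain d0 where d0: "d0 > 0" "G = group_closure {d0}"
    using group_closure_dense_or_cyclic[of "l1 - l0" "{l1 - l0, l2 - l0}"] distinct(1) G by auto
  then show "\<exists>d>0. G = group_closure {d}" by blast
  have comm: "\<exists>m1 m2 p1 p2. commensurable_trinomial l0 l1 l2 r0 r1 r2 d m1 m2 p1 p2"
    if d: "G = group_closure {d}" for d
  proof -
    have "l1 - l0 \<in> G" "l2 - l0 \<in> G" unfolding G by (auto intro: group_closure.base)
    then obtain m1 m2 :: int where m: "l1 - l0 = of_int m1 * d" "l2 - l0 = of_int m2 * d"
      unfolding d group_closure_single by auto
    have dne: "d \<noteq> 0" using m distinct by auto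
    have "d \<in> G" unfolding d by (auto intro: group_closure.base)
    \<comment> \<open>Writing the generator \<open>d\<close> through the two differences and
      dividing by \<open>d\<close> yields the Bezout identity.\<close>
    then obtain p1 p2 :: int where p: "d = of_int p1 * (l1 - l0) + of_int p2 * (l2 - l0)"
      unfolding G group_closure_pair by auto
    then have "d * of_int (p1 * m1 + p2 * m2) = d * 1" unfolding m by (simp add: algebra_simps)
    then have "real_of_int (p1 * m1 + p2 * m2) = 1" using dne by (simp only: mult_cancel_left) simp
    then have "p1 * m1 + p2 * m2 = 1" by linarith
    moreover have "m1 \<noteq> 0" "m2 \<noteq> 0" "m1 \<noteq> m2" using m distinct by auto
    ultimately have "commensurable_trinomial l0 l1 l2 r0 r1 r2 d m1 m2 p1 p2"
      using pos dne m by unfold_locales auto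
    then show ?thesis by blast
  qed
  show "\<forall>d. G = group_closure {d} \<longrightarrow>
      (\<forall>\<theta>0 \<theta>1 \<theta>2. minimizing_phases l0 l1 l2 r0 r1 r2 \<theta>0 \<theta>1 \<theta>2 \<longleftrightarrow>
        [\<theta>0 * (l2 - l1) + \<theta>1 * (l0 - l2) + \<theta>2 * (l1 - l0) = d * pi] (rmod (2 * d * pi)))"
    using comm commensurable_trinomial.minimizing_iff commensurable_trinomial.cong_iff by metis
  show "\<exists>\<theta>0\<in>{0, pi}. \<exists>\<theta>1\<in>{0, pi}. \<exists>\<theta>2\<in>{0, pi}.
      minimizing_phases l0 l1 l2 r0 r1 r2 \<theta>0 \<theta>1 \<theta>2"
    using comm[OF d0(2)] commensurable_trinomial.ex_minimizing by blast
qed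

end
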